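(* Let $\mathbb{F}$ be a finite field. For $i=1,2$ let $A_i\subseteq\mathbb{F}$ with $|A_i|=n_i$, let $\mathcal{A}_i$ be a partition of $A_i$ into sets of size $r_i+1$, let $\Phi_i:\mathbb{F}^{k_i}\to\mathcal{F}_{\mathcal{A}_i}^{r_i}$ be an injective linear mapping, and let $\mathcal{C}_i=\{(\Phi_i(a)(\alpha))_{\alpha\in A_i}:a\in\mathbb{F}^{k_i}\}\subseteq\mathbb{F}^{n_i}$ be the resulting $(n_i,k_i,r_i)$ LRC code; let $d_i$ be its minimum distance. Let $\Phi=\Phi_1\otimes\Phi_2$ be the tensor product mapping: for $a=(a_{jl})\in\mathbb{F}^{k_1k_2}$, $$f_a(x,y)=\Phi(a)=\sum_{j=1}^{k_1}\sum_{l=1}^{k_2}a_{jl}\,\Phi_1(e_j)(x)\,\Phi_2(e'_l)(y),$$ where $(e_j)$ and $(e'_l)$ are the standard bases of $\mathbb{F}^{k_1}$ and $\mathbb{F}^{k_2}$. Then the code $\{(f_a(\alpha,\beta))_{(\alpha,\beta)\in A_1\times A_2}:a\in\mathbb{F}^{k_1k_2}\}$ is an LRC$(2)$ code with parameters $(n=n_1n_2,\ k=k_1k_2,\ \{r_1,r_2\})$ and minimum distance $d=d_1d_2$.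
   Context: For a partition $\mathcal{A}$ of a set $A\subseteq\mathbb{F}$, $\mathbb{F}_{\mathcal{A}}[x]$ denotes the set of polynomials $f\in\mathbb{F}[x]$ with $\deg f<|A|$ that are constant on each block of $\mathcal{A}$, and $\mathcal{F}_{\mathcal{A}}^r=\bigoplus_{i=0}^{r-1}\mathbb{F}_{\mathcal{A}}[x]\,x^i$, where products of polynomials are taken modulo $h(x)=\prod_{a\in A}(x-a)$. An $(n,k,r)$ LRC code over $\mathbb{F}$ is a code of length $n$ and cardinality $|\mathbb{F}|^k$ such that every coordinate $i$ has a set of at most $r$ other coordinates whose symbols determine the symbol $x_i$ of every codeword $x$. An $(n,k,\{r_1,r_2\})$ LRC code (an LRC$(2)$ code) is a code $\mathcal{C}\subseteq\mathbb{F}^n$ of cardinality $|\mathbb{F}|^k$ such that for every coordinate $i$ there exist two disjoint sets $R_{i,1},R_{i,2}$ of coordinates, not containing $i$, of sizes $r_1$ and $r_2$ respectively, such that for codewords $x\in\mathcal{C}$ and each $j=1,2$ the symbol $x_i$ is a function of $(x_l)_{l\in R_{i,j}}$. *)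

theory Defs
  imports
    "HOL-Analysis.Analysis"
    "HOL-Computational_Algebra.Polynomial"
    "HOL-Library.Disjoint_Sets"
    "HOL-Library.FuncSet"
begin

text \<open>
  A word in \<open>F\<^sup>I\<close>, for a finite index set \<open>I\<close>, is an element of \<open>I \<rightarrow>\<^sub>E UNIV\<close>.
  Message spaces \<open>F\<^sup>k\<close> are the types \<open>'a ^ 'k\<close> with \<open>k = CARD('k)\<close>, so that \<open>k \<ge> 1\<close>;
  an array \<open>(a\<^sub>j\<^sub>l)\<close> in \<open>F\<^sup>k\<^sup>1\<^sup>k\<^sup>2\<close> is an element of \<open>'a ^ 'k2 ^ 'k1\<close>.
\<close>

section \<open>Codes\<close>

definition hamming_dist :: "'i set \<Rightarrow> ('i \<Rightarrow> 'a) \<Rightarrow> ('i \<Rightarrow> 'a) \<Rightarrow> nat" where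
  "hamming_dist I x y = card {i \<in> I. x i \<noteq> y i}"

text \<open>Meaningful only if the code is finite and has at least two codewords.\<close>

definition min_distance :: "'i set \<Rightarrow> ('i \<Rightarrow> 'a) set \<Rightarrow> nat" where
  "min_distance I C = Min {hamming_dist I x y | x y. x \<in> C \<and> y \<in> C \<and> x \<noteq> y}"

definition determines :: "('i \<Rightarrow> 'a) set \<Rightarrow> 'i set \<Rightarrow> 'i \<Rightarrow> bool" where
  "determines C R i \<longleftrightarrow> (\<exists>g. \<forall>x\<in>C. x i = g (restrict x R))"

definition LRC2_code ::
  "'i set \<Rightarrow> ('i \<Rightarrow> 'a::{field,finite}) set \<Rightarrow> nat \<Rightarrow> nat \<Rightarrow> nat \<Rightarrow> nat \<Rightarrow> bool" where
  "LRC2_code I C n k r1 r2 \<longleftrightarrow>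
     finite I \<and> card I = n \<and> C \<subseteq> I \<rightarrow>\<^sub>E UNIV \<and> card C = CARD('a) ^ k \<and>
     (\<forall>i\<in>I. \<exists>R1 R2. R1 \<subseteq> I - {i} \<and> R2 \<subseteq> I - {i} \<and> R1 \<inter> R2 = {} \<and>
        card R1 = r1 \<and> card R2 = r2 \<and> determines C R1 i \<and> determines C R2 i)"


section \<open>The polynomial spaces\<close>

text \<open>The disjunct \<open>f = 0\<close> is needed for \<open>A = {}\<close>, since \<open>degree 0 = 0\<close> in the library.\<close>

definition block_const_polys :: "'a::field set \<Rightarrow> 'a set set \<Rightarrow> 'a poly set" where
  "block_const_polys A P =
     {f. (f = 0 \<or> degree f < card A) \<and> (\<forall>B\<in>P. \<forall>x\<in>B. \<forall>y\<in>B. poly f x = poly f y)}"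

definition annihilator_poly :: "'a::field set \<Rightarrow> 'a poly" where
  "annihilator_poly A = (\<Prod>a\<in>A. [:- a, 1:])"

text \<open>
  This is the sum of the spaces \<open>F\<^sub>P[x] x\<^sup>i\<close> for \<open>i < r\<close>;
  it is direct when the blocks have \<open>r + 1\<close> elements, by \<open>lrc_poly_space_direct\<close> below.
\<close>

definition lrc_poly_space :: "'a::field set \<Rightarrow> 'a set set \<Rightarrow> nat \<Rightarrow> 'a poly set" where
  "lrc_poly_space A P r =
     {\<Sum>i<r. (g i * monom 1 i) mod annihilator_poly A | g. \<forall>i<r. g i \<in> block_const_polys A P}"

lemma poly_mod_annihilator_poly:
  assumes "finite A" "x \<in> A"
  shows "poly (f mod annihilator_poly A) x = poly f x"
proof -
  have "poly (annihilator_poly A) x = 0"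
    using assms by (auto simp: annihilator_poly_def poly_prod)
  then have "poly (f div annihilator_poly A * annihilator_poly A + f mod annihilator_poly A) x
      = poly (f mod annihilator_poly A) x"
    by (simp only: poly_add poly_mult mult_zero_right add_0_left)
  then show ?thesis
    by (simp only: div_mult_mod_eq)
qed

lemma lrc_poly_space_direct:
  assumes fin: "finite A" and part: "partition_on A P" and blocks: "\<forall>B\<in>P. card B = r + 1"
    and g: "\<forall>i<r. g i \<in> block_const_polys A P" and g': "\<forall>i<r. g' i \<in> block_const_polys A P"
    and eq: "(\<Sum>i<r. (g i * monom 1 i) mod annihilator_poly A) =
             (\<Sum>i<r. (g' i * monom 1 i) mod annihilator_poly A)"
    and i: "i < r"
  shows "g i = g' i"
proof -
  have zero: "poly (g i - g' i) b = 0" if b: "b \<in> A" for b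
  proof -
    obtain B where B: "B \<in> P" "b \<in> B"
      using part b by (auto simp: partition_on_def)
    have BA: "B \<subseteq> A"
      using part B by (auto simp: partition_on_def)
    define p where "p = (\<Sum>j<r. monom (poly (g j - g' j) b) j)"
    have "poly p x = 0" if x: "x \<in> B" for x
    proof -
      have "poly p x = (\<Sum>j<r. (poly (g j) x - poly (g' j) x) * x ^ j)"
        unfolding p_def poly_sum
      proof (intro sum.cong refl)
        fix j assume "j \<in> {..<r}"
        then have "poly (g j) x = poly (g j) b" "poly (g' j) x = poly (g' j) b"
          using g g' B x unfolding block_const_polys_def by blast+
        then show "poly (monom (poly (g j - g' j) b) j) x = (poly (g j) x - poly (g' j) x) * x ^ j"
          by (simp add: poly_monom)
      qed
      also have "\<dots> = poly (\<Sum>j<r. (g j * monom 1 j) mod annihilator_poly A) x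
                     - poly (\<Sum>j<r. (g' j * monom 1 j) mod annihilator_poly A) x"
        using x BA fin
        by (simp add: poly_sum poly_mod_annihilator_poly subsetD poly_monom sum_subtractf
            left_diff_distrib)
      finally show ?thesis
        by (simp add: eq)
    qed
    then have roots: "B \<subseteq> {x. poly p x = 0}"
      by auto
    have deg: "degree p \<le> r"
      unfolding p_def by (intro degree_sum_le) (auto intro: order.trans[OF degree_monom_le])
    have "p = 0"
    proof (rule ccontr)
      assume "p \<noteq> 0"
      then have "card B \<le> degree p"
        using card_mono[OF poly_roots_finite roots] card_poly_roots_bound[of p] by force
      then show False
        using deg blocks B by auto
    qed
    then have "coeff p i = 0"
      by simp
    then show ?thesis
      using i by (simp add: p_def coeff_sum)
  qed
  show ?thesis
  proof (rule ccontr)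
    assume "g i \<noteq> g' i"
    then have nz: "g i - g' i \<noteq> 0"
      by simp
    then have "card A \<le> degree (g i - g' i)"
      using zero card_mono[OF poly_roots_finite[OF nz], of A] card_poly_roots_bound[OF nz] by force
    moreover have "degree (g i) < card A \<or> g i = 0" "degree (g' i) < card A \<or> g' i = 0"
      using g g' i unfolding block_const_polys_def by blast+
    then have "degree (g i - g' i) < card A"
      using nz by (auto intro: degree_diff_less)
    ultimately show False
      by simp
  qed
qed


section \<open>Evaluation codes and the tensor product map\<close>

definition eval_code :: "'a::field set \<Rightarrow> ('m \<Rightarrow> 'a poly) \<Rightarrow> ('a \<Rightarrow> 'a) set" where
  "eval_code A \<Phi> = range (\<lambda>a. restrict (poly (\<Phi> a)) A)"

text \<open>
  Bivariate polynomials are elements of \<open>F[x][y]\<close>: the outer polynomial variable is \<open>y\<close>,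
  the coefficients are polynomials in \<open>x\<close>.
\<close>

definition tensor_map ::
  "('a::field ^ 'k1 \<Rightarrow> 'a poly) \<Rightarrow> ('a ^ 'k2 \<Rightarrow> 'a poly) \<Rightarrow> 'a ^ 'k2 ^ 'k1 \<Rightarrow> 'a poly poly" where
  "tensor_map \<Phi>1 \<Phi>2 a =
     (\<Sum>j\<in>UNIV. \<Sum>l\<in>UNIV.
        [:[:a $ j $ l:]:] * [:\<Phi>1 (axis j 1):] * map_poly (\<lambda>c. [:c:]) (\<Phi>2 (axis l 1)))"

definition poly_xy :: "'a::field poly poly \<Rightarrow> 'a \<Rightarrow> 'a \<Rightarrow> 'a" where
  "poly_xy f \<alpha> \<beta> = poly (poly f [:\<beta>:]) \<alpha>"

definition eval_code_xy ::
  "'a::field set \<Rightarrow> 'a set \<Rightarrow> ('m \<Rightarrow> 'a poly poly) \<Rightarrow> ('a \<times> 'a \<Rightarrow> 'a) set" where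
  "eval_code_xy A1 A2 \<Phi> = range (\<lambda>a. \<lambda>(\<alpha>, \<beta>) \<in> A1 \<times> A2. poly_xy (\<Phi> a) \<alpha> \<beta>)"

lemma poly_xy_tensor_map:
  "poly_xy (tensor_map \<Phi>1 \<Phi>2 a) \<alpha> \<beta> =
     (\<Sum>j\<in>UNIV. \<Sum>l\<in>UNIV. a $ j $ l * poly (\<Phi>1 (axis j 1)) \<alpha> * poly (\<Phi>2 (axis l 1)) \<beta>)"
proof -
  have "poly (map_poly (\<lambda>c. [:c:]) p) [:\<beta>:] = [:poly p \<beta>:]" for p :: "'a poly"
    by (induction p) (auto simp: map_poly_pCons)
  then show ?thesis
    by (simp add: poly_xy_def tensor_map_def poly_sum mult_ac)
qed

end

theory Submission
  imports Defs
begin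

text \<open>
  For fixed \<open>\<beta>\<close> the function \<open>\<alpha> \<mapsto> f\<^sub>a(\<alpha>, \<beta>)\<close> is a codeword of the first code, for fixed \<open>\<alpha>\<close> the
  function \<open>\<beta> \<mapsto> f\<^sub>a(\<alpha>, \<beta>)\<close> is one of the second. On a block an element of the space
  agrees with a polynomial of degree less than \<open>r\<close>, so each symbol is recovered along either line.
  The distance is the minimum weight: if row \<open>j\<close> of \<open>a\<close> is nonzero, its second codeword is nonzero
  at \<open>d\<^sub>2\<close> or more points \<open>\<beta>\<close>, and each of these carries a nonzero codeword of the first code;
  the product of two minimum weight codewords attains \<open>d\<^sub>1 d\<^sub>2\<close>.
\<close>

section \<open>Weights of linear codes\<close>

definition weight :: "'i set \<Rightarrow> ('i \<Rightarrow> 'a::zero) \<Rightarrow> nat" where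
  "weight I x = card {i \<in> I. x i \<noteq> 0}"

text \<open>The minimum runs over nonzero messages; for a linear encoding this is the minimum weight
  of the code as soon as only the message 0 is encoded as zero on \<open>I\<close>.\<close>

definition min_weight :: "'i set \<Rightarrow> ('m::zero \<Rightarrow> 'i \<Rightarrow> 'a::zero) \<Rightarrow> nat" where
  "min_weight I E = Min {weight I (E a) | a. a \<noteq> 0}"

text \<open>The message space may be infinite here; finiteness comes from the bound
  \<open>card I\<close> on every weight.\<close>

lemma finite_weights: "finite I \<Longrightarrow> finite {weight I (E a) | a. P a}"
  by (rule finite_subset[of _ "{..card I}"]) (auto simp: weight_def intro: card_mono)

lemma min_weight_le:
  assumes "finite I" "a \<noteq> 0"
  shows "min_weight I E \<le> weight I (E a)"
  unfolding min_weight_def using assms by (intro Min_le finite_weights) auto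

lemma min_weight_witness:
  fixes E :: "'m::zero \<Rightarrow> 'i \<Rightarrow> 'a::zero"
  assumes "finite I" "(b::'m) \<noteq> 0"
  obtains a where "a \<noteq> 0" "weight I (E a) = min_weight I E"
proof -
  have "Min {weight I (E a) | a. a \<noteq> 0} \<in> {weight I (E a) | a. a \<noteq> 0}"
    using assms by (intro Min_in finite_weights) auto
  then show ?thesis
    using that unfolding min_weight_def by auto
qed

lemma inj_restrict_encoding:
  fixes E :: "'m::group_add \<Rightarrow> 'i \<Rightarrow> 'a::group_add"
  assumes diff: "\<And>a b i. E (a - b) i = E a i - E b i"
    and ker: "\<And>a. \<forall>i\<in>I. E a i = 0 \<Longrightarrow> a = 0"
  shows "inj (\<lambda>a. restrict (E a) I)"
proof (rule injI)
  fix a b assume "restrict (E a) I = restrict (E b) I"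
  then have "\<forall>i\<in>I. E a i = E b i"
    by (metis restrict_apply')
  then have "\<forall>i\<in>I. E (a - b) i = 0"
    by (simp add: diff)
  then show "a = b"
    using ker[of "a - b"] by simp
qed

text \<open>The distance of two codewords is the weight of the encoded difference of their messages,
  and the trivial kernel makes this difference nonzero exactly when the codewords differ.\<close>

lemma min_distance_eq_min_weight:
  fixes E :: "'m::group_add \<Rightarrow> 'i \<Rightarrow> 'a::group_add"
  assumes diff: "\<And>a b i. E (a - b) i = E a i - E b i"
    and ker: "\<And>a. \<forall>i\<in>I. E a i = 0 \<Longrightarrow> a = 0"
  shows "min_distance I (range (\<lambda>a. restrict (E a) I)) = min_weight I E"
proof -
  let ?c = "\<lambda>a. restrict (E a) I"
  have dist: "hamming_dist I (?c a) (?c b) = weight I (E (a - b))" for a b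
    unfolding hamming_dist_def weight_def by (rule arg_cong[of _ _ card]) (auto simp: diff)
  have neq: "?c a \<noteq> ?c b \<longleftrightarrow> a - b \<noteq> 0" for a b
    using inj_restrict_encoding[of E I, OF diff ker] by (auto dest: injD)
  have "{hamming_dist I x y | x y. x \<in> range ?c \<and> y \<in> range ?c \<and> x \<noteq> y}
      = {weight I (E a) | a. a \<noteq> 0}" (is "?L = ?R")
  proof
    show "?L \<subseteq> ?R"
      using dist neq by blast
    show "?R \<subseteq> ?L"
    proof
      fix w assume "w \<in> ?R"
      then obtain a where "a \<noteq> 0" "w = weight I (E a)"
        by blast
      \<comment> \<open>The weight of \<open>E a\<close> is the distance of its codeword from that
        of the message 0.\<close>
      then show "w \<in> ?L"
        using dist[of a 0] neq[of a 0]
        by (intro CollectI exI[of _ "?c a"] exI[of _ "?c 0"] conjI rangeI) simp_all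
    qed
  qed
  then show ?thesis
    by (simp add: min_distance_def min_weight_def)
qed


section \<open>The tensor product of two linear codes\<close>

text \<open>The encoding whose generator matrix has the rows \<open>u j\<close>; the distance
  argument uses nothing about polynomials.\<close>

definition comb :: "('k \<Rightarrow> 'i \<Rightarrow> 'a) \<Rightarrow> 'a::field ^ 'k \<Rightarrow> 'i \<Rightarrow> 'a" where
  "comb u a i = (\<Sum>j\<in>UNIV. a $ j * u j i)"

text \<open>The generator matrix is the Kronecker product of \<open>u\<close> and \<open>v\<close>.
  With the message kept as an array, each row \<open>a $ j\<close> is a message of the second
  code.\<close>

definition tensor_comb ::
  "('k1 \<Rightarrow> 'i \<Rightarrow> 'a) \<Rightarrow> ('k2 \<Rightarrow> 'j \<Rightarrow> 'a) \<Rightarrow> 'a::field ^ 'k2 ^ 'k1 \<Rightarrow> 'i \<times> 'j \<Rightarrow> 'a" where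
  "tensor_comb u v a = (\<lambda>(x, y). \<Sum>j\<in>UNIV. \<Sum>l\<in>UNIV. a $ j $ l * u j x * v l y)"

lemma comb_diff: "comb u (a - b) i = comb u a i - comb u b i"
  by (simp add: comb_def left_diff_distrib sum_subtractf)

lemma tensor_comb_diff: "tensor_comb u v (a - b) p = tensor_comb u v a p - tensor_comb u v b p"
  by (simp add: tensor_comb_def left_diff_distrib sum_subtractf split: prod.split)

lemma tensor_comb_eq_comb_left:
  "tensor_comb u v a (x, y) = comb u (\<chi> j. comb v (a $ j) y) x"
  by (simp add: tensor_comb_def comb_def sum_distrib_right sum_distrib_left mult_ac)

text \<open>Exchanging the sums exposes the slices with fixed first coordinate, as recovery along
  the second coordinate requires.\<close>

lemma tensor_comb_eq_comb_right:
  "tensor_comb u v a (x, y) = comb v (\<chi> l. comb u (\<chi> j. a $ j $ l) x) y"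
  unfolding tensor_comb_def prod.case
  by (subst sum.swap) (simp add: comb_def sum_distrib_right sum_distrib_left mult_ac)

lemma tensor_comb_pure:
  "tensor_comb u v (\<chi> j l. b $ j * c $ l) (x, y) = comb u b x * comb v c y"
  by (simp add: tensor_comb_def comb_def sum_product mult_ac)

lemma weight_tensor_comb:
  assumes "finite I" "finite J"
  shows "weight (I \<times> J) (tensor_comb u v a)
    = (\<Sum>y\<in>J. weight I (comb u (\<chi> j. comb v (a $ j) y)))"
proof -
  let ?S = "\<lambda>y. {x \<in> I. comb u (\<chi> j. comb v (a $ j) y) x \<noteq> 0}"
  \<comment> \<open>The support is counted slice by slice over \<open>y\<close>, so \<open>y\<close>
    comes first in the dependent sum and \<open>prod.swap\<close> restores the order.\<close>
  have "{p \<in> I \<times> J. tensor_comb u v a p \<noteq> 0} = prod.swap ` (SIGMA y:J. ?S y)"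
    by (auto simp: tensor_comb_eq_comb_left)
  then show ?thesis
    using assms by (simp add: weight_def card_image)
qed

lemma weight_tensor_comb_ge:
  fixes a :: "'a::field ^ 'k2 ^ 'k1"
  assumes fin: "finite I" "finite J" and a: "a \<noteq> 0"
  shows "min_weight I (comb u) * min_weight J (comb v) \<le> weight (I \<times> J) (tensor_comb u v a)"
proof -
  obtain j where j: "a $ j \<noteq> 0"
    using a by (auto simp: vec_eq_iff)
  let ?T = "{y \<in> J. comb v (a $ j) y \<noteq> 0}"
  have "min_weight I (comb u) * min_weight J (comb v) \<le> card ?T * min_weight I (comb u)"
    using min_weight_le[OF fin(2) j, of "comb v"] by (simp add: weight_def mult.commute)
  also have "\<dots> = (\<Sum>y\<in>?T. min_weight I (comb u))"
    by simp
  also have "\<dots> \<le> (\<Sum>y\<in>?T. weight I (comb u (\<chi> j. comb v (a $ j) y)))"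
  proof (intro sum_mono min_weight_le fin)
    fix y assume "y \<in> ?T"
    \<comment> \<open>Entry \<open>j\<close> of the message of this slice is the symbol at
      \<open>y\<close> of the encoded row \<open>j\<close>, nonzero by the choice of
      \<open>?T\<close>.\<close>
    then have "(\<chi> j. comb v (a $ j) y) $ j \<noteq> 0"
      by simp
    then show "(\<chi> j. comb v (a $ j) y) \<noteq> 0"
      by (metis zero_index)
  qed
  also have "\<dots> \<le> (\<Sum>y\<in>J. weight I (comb u (\<chi> j. comb v (a $ j) y)))"
    using fin by (intro sum_mono2) auto
  finally show ?thesis
    using fin by (simp add: weight_tensor_comb)
qed

lemma weight_tensor_comb_pure:
  "weight (I \<times> J) (tensor_comb u v (\<chi> j l. b $ j * c $ l))
    = weight I (comb u b) * weight J (comb v c)"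
proof -
  have "{p \<in> I \<times> J. tensor_comb u v (\<chi> j l. b $ j * c $ l) p \<noteq> 0}
      = {x \<in> I. comb u b x \<noteq> 0} \<times> {y \<in> J. comb v c y \<noteq> 0}"
    by (auto simp: tensor_comb_pure)
  then show ?thesis
    by (simp add: weight_def card_cartesian_product)
qed

text \<open>Index types are inhabited, so the minima in \<open>min_weight\<close> range over
  nonempty sets.\<close>

lemma exists_nonzero_vec: "\<exists>b :: 'a::field ^ 'k. b \<noteq> 0"
  by (rule exI[of _ "axis undefined 1"]) simp

lemma min_weight_tensor_comb:
  fixes u :: "'k1::finite \<Rightarrow> 'i \<Rightarrow> 'a::field" and v :: "'k2::finite \<Rightarrow> 'j \<Rightarrow> 'a"
  assumes fin: "finite I" "finite J"
  shows "min_weight (I \<times> J) (tensor_comb u v) = min_weight I (comb u) * min_weight J (comb v)"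
proof (rule antisym)
  obtain b where b: "b \<noteq> 0" "weight I (comb u b) = min_weight I (comb u)"
    using exists_nonzero_vec min_weight_witness[OF fin(1)] by metis
  obtain c where c: "c \<noteq> 0" "weight J (comb v c) = min_weight J (comb v)"
    using exists_nonzero_vec min_weight_witness[OF fin(2)] by metis
  \<comment> \<open>The weight of a rank one array is the product of the weights of its two
    factors.\<close>
  let ?bc = "\<chi> j l. b $ j * c $ l"
  have "?bc \<noteq> 0"
    using b(1) c(1) by (auto simp: vec_eq_iff)
  then show "min_weight (I \<times> J) (tensor_comb u v) \<le> min_weight I (comb u) * min_weight J (comb v)"
    using min_weight_le[of "I \<times> J" ?bc "tensor_comb u v"] fin b c
    by (simp add: weight_tensor_comb_pure)
  obtain a :: "'a ^ 'k2 ^ 'k1"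
    where "a \<noteq> 0" "weight (I \<times> J) (tensor_comb u v a) = min_weight (I \<times> J) (tensor_comb u v)"
    using \<open>?bc \<noteq> 0\<close> min_weight_witness[of "I \<times> J" ?bc] fin by (metis finite_cartesian_product)
  then show "min_weight I (comb u) * min_weight J (comb v) \<le> min_weight (I \<times> J) (tensor_comb u v)"
    using weight_tensor_comb_ge[OF fin, of a u v] by simp
qed

text \<open>For each \<open>y\<close> the slice vanishes on \<open>I\<close>, so
  \<open>ker_u\<close> kills its message; hence every encoded row vanishes on \<open>J\<close>, and
  \<open>ker_v\<close> kills the row.\<close>

lemma tensor_comb_kernel:
  assumes ker_u: "\<And>b. \<forall>i\<in>I. comb u b i = 0 \<Longrightarrow> b = 0"
    and ker_v: "\<And>c. \<forall>j\<in>J. comb v c j = 0 \<Longrightarrow> c = 0"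
    and zero: "\<forall>p\<in>I \<times> J. tensor_comb u v a p = 0"
  shows "a = 0"
proof -
  have "(\<chi> j. comb v (a $ j) y) = 0" if "y \<in> J" for y
    using zero that by (intro ker_u) (auto simp: tensor_comb_eq_comb_left)
  then have "comb v (a $ j) y = 0" if "y \<in> J" for j y
    using that by (metis vec_lambda_beta zero_index)
  then have "a $ j = 0" for j
    by (intro ker_v) auto
  then show ?thesis
    by (simp add: vec_eq_iff)
qed


section \<open>Local recovery\<close>

text \<open>This trades the recovery function for a comparison of two codewords, the form that root
  counting delivers.\<close>

lemma determines_iff:
  "determines C R i \<longleftrightarrow> (\<forall>x\<in>C. \<forall>y\<in>C. restrict x R = restrict y R \<longrightarrow> x i = y i)"
proof
  assume *: "\<forall>x\<in>C. \<forall>y\<in>C. restrict x R = restrict y R \<longrightarrow> x i = y i"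
  \<comment> \<open>Any codeword restricting to \<open>z\<close> yields the symbol; the value is
    arbitrary if there is none.\<close>
  define g where "g z = (SOME y. y \<in> C \<and> restrict y R = z) i" for z
  have "x i = g (restrict x R)" if x: "x \<in> C" for x
  proof -
    let ?y = "SOME y. y \<in> C \<and> restrict y R = restrict x R"
    have y: "?y \<in> C \<and> restrict ?y R = restrict x R"
      by (rule someI[of _ x]) (intro conjI x refl)
    have "x i = ?y i"
      by (rule *[rule_format, OF x conjunct1[OF y] conjunct2[OF y, symmetric]])
    then show ?thesis
      by (simp only: g_def)
  qed
  then show "determines C R i"
    unfolding determines_def by (intro exI[of _ g] ballI)
next
  assume "determines C R i"
  then obtain g where "\<forall>x\<in>C. x i = g (restrict x R)"
    unfolding determines_def by (elim exE)
  note g = bspec[OF this]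
  show "\<forall>x\<in>C. \<forall>y\<in>C. restrict x R = restrict y R \<longrightarrow> x i = y i"
  proof (intro ballI impI)
    fix x y assume "x \<in> C" "y \<in> C" "restrict x R = restrict y R"
    then show "x i = y i"
      by (simp only: g[OF \<open>x \<in> C\<close>] g[OF \<open>y \<in> C\<close>])
  qed
qed

section \<open>Root counting in \<open>lrc_poly_space\<close>\<close>

lemma annihilator_poly_nonzero: "finite A \<Longrightarrow> annihilator_poly A \<noteq> 0"
  by (simp add: annihilator_poly_def)

lemma degree_annihilator_poly: "degree (annihilator_poly A) = card A"
  by (simp add: annihilator_poly_def degree_prod_eq_sum_degree)

lemma poly_mod_sum: "(\<Sum>i\<in>S. f i) mod p = (\<Sum>i\<in>S. f i mod p)" for p :: "'a::field poly"
  by (induction S rule: infinite_finite_induct) (simp_all add: poly_mod_add_left)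

text \<open>Each element is a remainder modulo \<open>annihilator_poly A\<close>, so if nonzero it
  has degree below \<open>card A\<close> and cannot vanish on all of \<open>A\<close>.\<close>

lemma lrc_poly_space_zero:
  fixes A :: "'a::field set"
  assumes fin: "finite A" and f: "f \<in> lrc_poly_space A P r" and zero: "\<forall>x\<in>A. poly f x = 0"
  shows "f = 0"
proof (rule ccontr)
  assume nz: "f \<noteq> 0"
  obtain g where "f = (\<Sum>i<r. (g i * monom 1 i) mod annihilator_poly A)"
    using f by (auto simp: lrc_poly_space_def)
  then have "f = (\<Sum>i<r. g i * monom 1 i) mod annihilator_poly A"
    by (simp add: poly_mod_sum)
  then have "degree f < card A"
    using nz degree_mod_less[OF annihilator_poly_nonzero[OF fin]] by (metis degree_annihilator_poly)
  moreover have "card A \<le> degree f"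
    using zero card_mono[OF poly_roots_finite[OF nz], of A] card_poly_roots_bound[OF nz] by force
  ultimately show False
    by simp
qed

text \<open>Reduction does not change values on \<open>A\<close>, and each \<open>g i\<close> can be
  frozen at one point of the block. The bound is put on coefficients because
  \<open>degree p < r\<close> would fail for \<open>r = 0\<close>.\<close>

lemma lrc_poly_space_on_block:
  fixes A :: "'a::field set"
  assumes fin: "finite A" and B: "B \<in> P" "B \<subseteq> A" and f: "f \<in> lrc_poly_space A P r"
  obtains p where "\<forall>i\<ge>r. coeff p i = 0" "\<forall>x\<in>B. poly f x = poly p x"
proof (cases "B = {}")
  case True
  then show ?thesis
    using that[of 0] by simp
next
  case False
  then obtain b where b: "b \<in> B"
    by auto
  obtain g where f_eq: "f = (\<Sum>i<r. (g i * monom 1 i) mod annihilator_poly A)"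
    and g: "\<forall>i<r. g i \<in> block_const_polys A P"
    using f by (auto simp: lrc_poly_space_def)
  let ?p = "\<Sum>i<r. monom (poly (g i) b) i"
  have "poly f x = poly ?p x" if x: "x \<in> B" for x
  proof -
    have "poly (g i) x = poly (g i) b" if "i < r" for i
      using g that B b x unfolding block_const_polys_def by blast
    moreover have "x \<in> A"
      using x B by auto
    ultimately show ?thesis
      by (simp add: f_eq poly_sum poly_mod_annihilator_poly[OF fin] poly_monom)
  qed
  moreover have "\<forall>i\<ge>r. coeff ?p i = 0"
    by (auto simp: coeff_sum)
  ultimately show ?thesis
    using that by blast
qed

text \<open>The two local polynomials agree at \<open>r\<close> points, and their difference, if
  nonzero, has degree below \<open>r\<close>.\<close>

lemma lrc_poly_space_recover:
  fixes A :: "'a::field set"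
  assumes fin: "finite A" and B: "B \<in> P" "B \<subseteq> A" "card B = r + 1" and b: "b \<in> B"
    and f: "f \<in> lrc_poly_space A P r" "f' \<in> lrc_poly_space A P r"
    and eq: "\<forall>x\<in>B - {b}. poly f x = poly f' x"
  shows "poly f b = poly f' b"
proof -
  obtain p where p: "\<forall>i\<ge>r. coeff p i = 0" "\<forall>x\<in>B. poly f x = poly p x"
    using lrc_poly_space_on_block[OF fin B(1,2) f(1)] .
  obtain p' where p': "\<forall>i\<ge>r. coeff p' i = 0" "\<forall>x\<in>B. poly f' x = poly p' x"
    using lrc_poly_space_on_block[OF fin B(1,2) f(2)] .
  have "p - p' = 0"
  proof (rule ccontr)
    assume nz: "p - p' \<noteq> 0"
    have "\<not> r \<le> degree (p - p')"
      using nz p(1) p'(1) by (metis coeff_diff diff_zero leading_coeff_0_iff)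
    moreover have "card (B - {b}) \<le> degree (p - p')"
      using eq p(2) p'(2) card_mono[OF poly_roots_finite[OF nz], of "B - {b}"]
        card_poly_roots_bound[OF nz] by force
    ultimately show False
      using B b by simp
  qed
  then show ?thesis
    using p p' b by simp
qed

section \<open>From polynomial encodings to generator matrices\<close>

lemma linear_poly_eq_comb:
  fixes \<Phi> :: "'a::field ^ 'k \<Rightarrow> 'a poly"
  assumes "Vector_Spaces.linear (*s) smult \<Phi>"
  shows "poly (\<Phi> a) x = comb (\<lambda>j. poly (\<Phi> (axis j 1))) a x"
proof -
  interpret Vector_Spaces.linear "(*s)" smult \<Phi>
    by (fact assms)
  have "\<Phi> a = \<Phi> (\<Sum>j\<in>UNIV. a $ j *s axis j 1)"
    by (simp add: basis_expansion)
  also have "\<dots> = (\<Sum>j\<in>UNIV. smult (a $ j) (\<Phi> (axis j 1)))"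
    by (simp add: sum scale)
  finally show ?thesis
    by (simp add: comb_def poly_sum)
qed

lemma lrc_encoding_kernel:
  fixes \<Phi> :: "'a::field ^ 'k \<Rightarrow> 'a poly"
  assumes "finite A" "Vector_Spaces.linear (*s) smult \<Phi>" "inj \<Phi>"
    and "range \<Phi> \<subseteq> lrc_poly_space A P r" and "\<forall>x\<in>A. poly (\<Phi> a) x = 0"
  shows "a = 0"
proof -
  interpret Vector_Spaces.linear "(*s)" smult \<Phi>
    by (fact assms)
  have "\<Phi> a = 0"
    using assms by (intro lrc_poly_space_zero[of A _ P r]) auto
  then show ?thesis
    using \<open>inj \<Phi>\<close> by (metis injD zero)
qed

theorem proposition4p7:
  fixes A1 A2 :: "'a::{field,finite} set"
    and P1 P2 :: "'a set set"
    and n1 n2 r1 r2 d1 d2 :: nat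
    and \<Phi>1 :: "'a ^ 'k1 \<Rightarrow> 'a poly"
    and \<Phi>2 :: "'a ^ 'k2 \<Rightarrow> 'a poly"
  assumes "card A1 = n1" and "card A2 = n2"
    and "partition_on A1 P1" and "\<forall>B\<in>P1. card B = r1 + 1"
    and "partition_on A2 P2" and "\<forall>B\<in>P2. card B = r2 + 1"
    and "Vector_Spaces.linear (*s) smult \<Phi>1" and "inj \<Phi>1" and "range \<Phi>1 \<subseteq> lrc_poly_space A1 P1 r1"
    and "Vector_Spaces.linear (*s) smult \<Phi>2" and "inj \<Phi>2" and "range \<Phi>2 \<subseteq> lrc_poly_space A2 P2 r2"
    and "d1 = min_distance A1 (eval_code A1 \<Phi>1)"
    and "d2 = min_distance A2 (eval_code A2 \<Phi>2)"
  shows "LRC2_code (A1 \<times> A2) (eval_code_xy A1 A2 (tensor_map \<Phi>1 \<Phi>2))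
           (n1 * n2) (CARD('k1) * CARD('k2)) r1 r2
         \<and> min_distance (A1 \<times> A2) (eval_code_xy A1 A2 (tensor_map \<Phi>1 \<Phi>2)) = d1 * d2"
proof -
  define u where "u = (\<lambda>j. poly (\<Phi>1 (axis j 1)))"
  define v where "v = (\<lambda>l. poly (\<Phi>2 (axis l 1)))"
  let ?T = "tensor_comb u v" and ?C = "eval_code_xy A1 A2 (tensor_map \<Phi>1 \<Phi>2)"
  have fin: "finite A1" "finite A2"
    by auto
  have u: "poly (\<Phi>1 b) = comb u b" for b
    unfolding u_def by (rule ext) (rule linear_poly_eq_comb[OF assms(7)])
  have v: "poly (\<Phi>2 c) = comb v c" for c
    unfolding v_def by (rule ext) (rule linear_poly_eq_comb[OF assms(10)])
  have ker_u: "b = 0" if "\<forall>x\<in>A1. comb u b x = 0" for b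
    using lrc_encoding_kernel[OF fin(1) assms(7-9)] that by (simp add: u)
  have ker_v: "c = 0" if "\<forall>y\<in>A2. comb v c y = 0" for c
    using lrc_encoding_kernel[OF fin(2) assms(10-12)] that by (simp add: v)
  have ker: "a = 0" if "\<forall>p\<in>A1 \<times> A2. ?T a p = 0" for a
    using tensor_comb_kernel[OF ker_u ker_v that] .
  have T_xy: "(\<lambda>(\<alpha>, \<beta>). poly_xy (tensor_map \<Phi>1 \<Phi>2 a) \<alpha> \<beta>) = ?T a" for a
    by (simp add: poly_xy_tensor_map tensor_comb_def u_def v_def)
  have C: "?C = range (\<lambda>a. restrict (?T a) (A1 \<times> A2))"
    by (simp only: eval_code_xy_def T_xy)

  have "card ?C = CARD('a ^ 'k2 ^ 'k1)"
    unfolding C by (rule card_image) (rule inj_restrict_encoding[OF tensor_comb_diff ker])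
  then have card_C: "card ?C = CARD('a) ^ (CARD('k1) * CARD('k2))"
    by (simp add: power_mult[symmetric] mult.commute)

  have recovery: "\<exists>R1 R2. R1 \<subseteq> A1 \<times> A2 - {(x, y)} \<and> R2 \<subseteq> A1 \<times> A2 - {(x, y)} \<and> R1 \<inter> R2 = {} \<and>
      card R1 = r1 \<and> card R2 = r2 \<and> determines ?C R1 (x, y) \<and> determines ?C R2 (x, y)"
    if x: "x \<in> A1" and y: "y \<in> A2" for x y
  proof -
    obtain B1 where B1: "B1 \<in> P1" "x \<in> B1" "B1 \<subseteq> A1"
      using assms(3) x by (auto simp: partition_on_def)
    obtain B2 where B2: "B2 \<in> P2" "y \<in> B2" "B2 \<subseteq> A2"
      using assms(5) y by (auto simp: partition_on_def)
    \<comment> \<open>The recovery sets lie on the two axis-parallel lines through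
      \<open>(x, y)\<close>, which meet only in that point.\<close>
    let ?R1 = "(B1 - {x}) \<times> {y}" and ?R2 = "{x} \<times> (B2 - {y})"
    have R: "?R1 \<subseteq> A1 \<times> A2 - {(x, y)}" "?R2 \<subseteq> A1 \<times> A2 - {(x, y)}" "?R1 \<inter> ?R2 = {}"
      using B1 B2 x y by auto
    have card_R: "card ?R1 = r1" "card ?R2 = r2"
      using assms(4,6) B1 B2 by (auto simp: card_cartesian_product)
    \<comment> \<open>Codewords are already restricted to the grid, so two nested restrictions must
      be stripped to compare symbols.\<close>
    have agree: "?T a p = ?T a' p"
      if "restrict (restrict (?T a) (A1 \<times> A2)) R = restrict (restrict (?T a') (A1 \<times> A2)) R"
        and "p \<in> R" "R \<subseteq> A1 \<times> A2 - {(x, y)}" for a a' R p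
      using fun_cong[OF that(1), of p] that(2,3) by auto
    have "determines ?C ?R1 (x, y)"
      unfolding determines_iff C
    proof (intro ballI impI, elim imageE, hypsubst)
      fix a a'
      assume eq: "restrict (restrict (?T a) (A1 \<times> A2)) ?R1 = restrict (restrict (?T a') (A1 \<times> A2)) ?R1"
      \<comment> \<open>Along the line through \<open>y\<close>, both codewords are evaluations of
        polynomials in the range of \<open>\<Phi>1\<close>, so recovery on \<open>B1\<close>
        applies.\<close>
      have "poly (\<Phi>1 (\<chi> j. comb v (a $ j) y)) x = poly (\<Phi>1 (\<chi> j. comb v (a' $ j) y)) x"
      proof (rule lrc_poly_space_recover[OF fin(1) B1(1,3) _ B1(2)])
        show "\<forall>z\<in>B1 - {x}. poly (\<Phi>1 (\<chi> j. comb v (a $ j) y)) z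
            = poly (\<Phi>1 (\<chi> j. comb v (a' $ j) y)) z"
          using agree[OF eq _ R(1), of "(_, y)"] by (simp add: u tensor_comb_eq_comb_left)
      qed (use assms(4,9) B1 in auto)
      then show "restrict (?T a) (A1 \<times> A2) (x, y) = restrict (?T a') (A1 \<times> A2) (x, y)"
        using x y by (simp add: u tensor_comb_eq_comb_left)
    qed
    moreover have "determines ?C ?R2 (x, y)"
      unfolding determines_iff C
    proof (intro ballI impI, elim imageE, hypsubst)
      fix a a'
      assume eq: "restrict (restrict (?T a) (A1 \<times> A2)) ?R2 = restrict (restrict (?T a') (A1 \<times> A2)) ?R2"
      let ?w = "\<lambda>a. \<chi> l. comb u (\<chi> j. a $ j $ l) x"
      have "poly (\<Phi>2 (?w a)) y = poly (\<Phi>2 (?w a')) y"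
      proof (rule lrc_poly_space_recover[OF fin(2) B2(1,3) _ B2(2)])
        show "\<forall>z\<in>B2 - {y}. poly (\<Phi>2 (?w a)) z = poly (\<Phi>2 (?w a')) z"
          using agree[OF eq _ R(2), of "(x, _)"] by (simp add: v tensor_comb_eq_comb_right)
      qed (use assms(6,12) B2 in auto)
      then show "restrict (?T a) (A1 \<times> A2) (x, y) = restrict (?T a') (A1 \<times> A2) (x, y)"
        using x y by (simp add: v tensor_comb_eq_comb_right)
    qed
    ultimately show ?thesis
      using R card_R by blast
  qed

  have d1: "d1 = min_weight A1 (comb u)"
    unfolding assms(13) eval_code_def u by (rule min_distance_eq_min_weight[OF comb_diff ker_u])
  have d2: "d2 = min_weight A2 (comb v)"
    unfolding assms(14) eval_code_def v by (rule min_distance_eq_min_weight[OF comb_diff ker_v])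
  have "min_distance (A1 \<times> A2) ?C = min_weight (A1 \<times> A2) ?T"
    unfolding C by (rule min_distance_eq_min_weight[OF tensor_comb_diff ker])
  then have "min_distance (A1 \<times> A2) ?C = d1 * d2"
    by (simp add: min_weight_tensor_comb d1 d2)
  moreover have "LRC2_code (A1 \<times> A2) ?C (n1 * n2) (CARD('k1) * CARD('k2)) r1 r2"
    unfolding LRC2_code_def
  proof (intro conjI)
    show "card (A1 \<times> A2) = n1 * n2"
      using assms(1,2) by (simp add: card_cartesian_product)
    show "?C \<subseteq> A1 \<times> A2 \<rightarrow>\<^sub>E UNIV"
      unfolding C by (intro image_subsetI restrict_PiE_iff[THEN iffD2] ballI UNIV_I)
  qed (use fin card_C recovery in blast)+
  ultimately show ?thesis
    by blast
qed

end
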